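(* Consider an optimal control problem of the form (P) with a single input ($m=1$), that is, $$\text{minimize } \int_0^{T_f(u)} \big(f_0(x)+g_{01}(x)u\big)\,dt \quad\text{subject to}\quad \dot x=f(x)+g_1(x)u,\ \ |u(t)|\le K(t)\ \forall t\in[0,T_f(u)],\ \ x(0)=A,\ \ x(T_f(u))=B,$$ where $x\in\mathbb{R}^n$, $u:[0,T_f(u)]\to\mathbb{R}$ is a measurable control, $f,g_1$ are analytic vector fields on $\mathbb{R}^n$, $f_0,g_{01}:\mathbb{R}^n\to\mathbb{R}$ are analytic, and $K$ is analytic and strictly positive. Whenever the intrinsic order (problem order) $q=k/2$ of this problem is defined, i.e. whenever there is an $l\ge 1$ with $B_l$ defined and not identically zero (and $k$ is the least such $l$), $q$ is a positive integer.
   Context: Augmented system: put $\bar x=(x_0,x)\in\mathbb{R}^{n+1}$, $\bar f(\bar x)=(f_0(x),f(x))$, $\bar g(\bar x)=(g_{01}(x),g_1(x))$, which are analytic vector fields on $\mathbb{R}^{n+1}$ not depending on $x_0$, and let $\bar p\in\mathbb{R}^{n+1}$ denote the adjoint variable. The Hamiltonian is $H=\langle \bar p,\bar f(\bar x)\rangle+\langle\bar p,\bar g(\bar x)\rangle u$, and the extremal equations are $$\dot{\bar x}=\bar f(\bar x)+\bar g(\bar x)u,\qquad \dot{\bar p}=-\bar p\,\frac{\partial \bar f}{\partial \bar x}(\bar x)-\bar p\,\frac{\partial \bar g}{\partial \bar x}(\bar x)\,u ,$$ with $\bar p$ regarded as a row vector. Problem order (intrinsic order): let $\phi^{(0)}(\bar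 x,\bar p)=\langle\bar p,\bar g(\bar x)\rangle$. As long as $\phi^{(l)}$ does not depend on $u$, i.e. it is a function of $(\bar x,\bar p)$ only, let $\phi^{(l+1)}$ be its time derivative along the extremal equations, $$\phi^{(l+1)}(\bar x,\bar p,u)=\frac{\partial\phi^{(l)}}{\partial\bar x}\big(\bar f+\bar g u\big)+\frac{\partial\phi^{(l)}}{\partial\bar p}\Big(-\bar p\frac{\partial\bar f}{\partial\bar x}-\bar p\frac{\partial\bar g}{\partial\bar x}u\Big)^{T}=A_{l+1}(\bar x,\bar p)+B_{l+1}(\bar x,\bar p)\,u ,$$ so that $B_{l+1}=\partial\phi^{(l+1)}/\partial u$. Let $k\ge 1$ be the first index for which $B_k$ is not identically zero as a function of $(\bar x,\bar p)\in\mathbb{R}^{n+1}\times\mathbb{R}^{n+1}$ (so $B_1,\dots,B_{k-1}$ vanish identically). The problem order (intrinsic order) is $q=k/2$. *)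

theory Defs
  imports "HOL-Analysis.Analysis"
begin

text \<open>Real analyticity relative to a set S: near every point of S, f is the sum of a convergent
  power series in the coordinates. The multi-indices are the functions from the standard basis to
  the naturals; unconditional summation (\<open>has_sum\<close>) makes their ordering irrelevant.\<close>

definition real_analytic_on ::
  "('a::euclidean_space \<Rightarrow> 'b::real_normed_vector) \<Rightarrow> 'a set \<Rightarrow> bool"
  (infixl "real'_analytic'_on" 50) where
  "f real_analytic_on S \<longleftrightarrow>
     (\<forall>a\<in>S. \<exists>(c :: ('a \<Rightarrow> nat) \<Rightarrow> 'b) r. 0 < r \<and>
        (\<forall>y\<in>S. dist y a < r \<longrightarrow>
           ((\<lambda>\<alpha>. (\<Prod>b\<in>Basis. ((y - a) \<bullet> b) ^ \<alpha> b) *\<^sub>R c \<alpha>) has_sum f y)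
             (Basis \<rightarrow>\<^sub>E UNIV)))"

text \<open>The data of problem (P): minimise the integral of \<open>f\<^sub>0 x + g\<^sub>0\<^sub>1 x u\<close> subject to
  \<open>x' = f x + g\<^sub>1 x u\<close>, \<open>\<bar>u\<bar> \<le> K\<close>, \<open>x 0 = A\<close>, \<open>x T = B\<close>. The fields are, in this order,
  \<open>f\<^sub>0\<close>, \<open>g\<^sub>0\<^sub>1\<close>, \<open>f\<close>, \<open>g\<^sub>1\<close>, \<open>K\<close>, \<open>A\<close>, \<open>B\<close>.\<close>

record ('n::finite) control_problem =
  cost_drift :: "real^'n \<Rightarrow> real"
  cost_input :: "real^'n \<Rightarrow> real"
  drift :: "real^'n \<Rightarrow> real^'n"
  input_field :: "real^'n \<Rightarrow> real^'n"
  input_bound :: "real \<Rightarrow> real"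
  start_point :: "real^'n"
  end_point :: "real^'n"

definition analytic_problem :: "'n::finite control_problem \<Rightarrow> bool" where
  "analytic_problem P \<longleftrightarrow>
     cost_drift P real_analytic_on UNIV \<and> cost_input P real_analytic_on UNIV \<and>
     drift P real_analytic_on UNIV \<and> input_field P real_analytic_on UNIV \<and>
     input_bound P real_analytic_on {0..} \<and> (\<forall>t\<ge>0. 0 < input_bound P t)"

text \<open>The final time is the right end point T of the interval on which u is defined, so it is
  carried along with u. The differential equation holds in the sense of Caratheodory.\<close>

definition admissible ::
  "'n::finite control_problem \<Rightarrow> real \<Rightarrow> (real \<Rightarrow> real) \<Rightarrow> (real \<Rightarrow> real^'n) \<Rightarrow> bool" where
  "admissible P T u x \<longleftrightarrow>
     0 \<le> T \<and> u \<in> borel_measurable (lebesgue_on {0..T}) \<and>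
     (\<forall>t\<in>{0..T}. \<bar>u t\<bar> \<le> input_bound P t) \<and>
     (\<lambda>t. drift P (x t) + u t *\<^sub>R input_field P (x t)) absolutely_integrable_on {0..T} \<and>
     (\<forall>t\<in>{0..T}. x t = start_point P +
        integral {0..t} (\<lambda>s. drift P (x s) + u s *\<^sub>R input_field P (x s))) \<and>
     x T = end_point P"

definition cost ::
  "'n::finite control_problem \<Rightarrow> real \<Rightarrow> (real \<Rightarrow> real) \<Rightarrow> (real \<Rightarrow> real^'n) \<Rightarrow> real" where
  "cost P T u x = integral {0..T} (\<lambda>t. cost_drift P (x t) + cost_input P (x t) * u t)"

definition optimal ::
  "'n::finite control_problem \<Rightarrow> real \<Rightarrow> (real \<Rightarrow> real) \<Rightarrow> (real \<Rightarrow> real^'n) \<Rightarrow> bool" where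
  "optimal P T u x \<longleftrightarrow> admissible P T u x \<and>
     (\<forall>T' u' x'. admissible P T' u' x' \<longrightarrow> cost P T u x \<le> cost P T' u' x')"

text \<open>The space of the augmented variables \<open>(x\<^sub>0, x)\<close>, and of the adjoint variables.\<close>

type_synonym 'n augmented = "real \<times> (real^'n)"

definition aug_drift :: "'n::finite control_problem \<Rightarrow> 'n augmented \<Rightarrow> 'n augmented" where
  "aug_drift P X = (cost_drift P (snd X), drift P (snd X))"

definition aug_input :: "'n::finite control_problem \<Rightarrow> 'n augmented \<Rightarrow> 'n augmented" where
  "aug_input P X = (cost_input P (snd X), input_field P (snd X))"

text \<open>The product of the row vector p with the Jacobian matrix of F at X, read as an element of
  the space itself, is the adjoint of the derivative of F at X applied to p.\<close>

definition row_times_jacobian ::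
  "'a::euclidean_space \<Rightarrow> ('a \<Rightarrow> 'a) \<Rightarrow> 'a \<Rightarrow> 'a" where
  "row_times_jacobian p F X = adjoint (frechet_derivative F (at X)) p"

definition state_velocity ::
  "'n::finite control_problem \<Rightarrow> 'n augmented \<Rightarrow> real \<Rightarrow> 'n augmented" where
  "state_velocity P X u = aug_drift P X + u *\<^sub>R aug_input P X"

definition adjoint_velocity ::
  "'n::finite control_problem \<Rightarrow> 'n augmented \<Rightarrow> 'n augmented \<Rightarrow> real \<Rightarrow> 'n augmented" where
  "adjoint_velocity P X p u =
     - row_times_jacobian p (aug_drift P) X - u *\<^sub>R row_times_jacobian p (aug_input P) X"

definition extremal_derivative ::
  "'n::finite control_problem \<Rightarrow> ('n augmented \<Rightarrow> 'n augmented \<Rightarrow> real) \<Rightarrow>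
     'n augmented \<Rightarrow> 'n augmented \<Rightarrow> real \<Rightarrow> real" where
  "extremal_derivative P \<psi> X p u =
     frechet_derivative (\<lambda>Y. \<psi> Y p) (at X) (state_velocity P X u) +
     frechet_derivative (\<lambda>r. \<psi> X r) (at p) (adjoint_velocity P X p u)"

text \<open>\<open>switching P l X p u\<close> is \<open>\<phi>\<^sup>(\<^sup>l\<^sup>)(X, p, u)\<close>. It is meaningful only if \<open>switching_defined P l\<close>
  holds; then \<open>\<phi>\<^sup>(\<^sup>0\<^sup>), \<dots>, \<phi>\<^sup>(\<^sup>l\<^sup>-\<^sup>1\<^sup>)\<close> do not depend on u, so that the value u = 0 inserted in the
  recursion is immaterial.\<close>

primrec switching ::
  "'n::finite control_problem \<Rightarrow> nat \<Rightarrow> 'n augmented \<Rightarrow> 'n augmented \<Rightarrow> real \<Rightarrow> real" where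
  "switching P 0 = (\<lambda>X p u. p \<bullet> aug_input P X)"
| "switching P (Suc l) = extremal_derivative P (\<lambda>X p. switching P l X p 0)"

definition switching_defined :: "'n::finite control_problem \<Rightarrow> nat \<Rightarrow> bool" where
  "switching_defined P l \<longleftrightarrow>
     (\<forall>j<l. \<forall>X p u v. switching P j X p u = switching P j X p v)"

text \<open>\<open>input_coeff P l\<close> is \<open>B\<^sub>l = \<partial>\<phi>\<^sup>(\<^sup>l\<^sup>)/\<partial>u\<close>. As \<open>\<phi>\<^sup>(\<^sup>l\<^sup>)\<close> is affine in u, the point at which
  the derivative is taken is immaterial.\<close>

definition input_coeff ::
  "'n::finite control_problem \<Rightarrow> nat \<Rightarrow> 'n augmented \<Rightarrow> 'n augmented \<Rightarrow> real" where
  "input_coeff P l X p = deriv (\<lambda>u. switching P l X p u) 0"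

definition input_appears :: "'n::finite control_problem \<Rightarrow> nat \<Rightarrow> bool" where
  "input_appears P l \<longleftrightarrow> 1 \<le> l \<and> switching_defined P l \<and> (\<exists>X p. input_coeff P l X p \<noteq> 0)"

definition problem_order :: "'n::finite control_problem \<Rightarrow> real" where
  "problem_order P = real (LEAST l. input_appears P l) / 2"

end

theory Submission
  imports Defs
begin

text \<open>Let \<open>f\<close> and \<open>g\<close> be the augmented drift and input field, and let \<open>ad\<^sub>f\<close> denote the Lie bracket
  with \<open>f\<close>. The adjoint equation is made such that for every smooth vector field \<open>V\<close> the function
  \<open>p \<bullet> V x\<close> has the time derivative \<open>p \<bullet> [f, V] x + u (p \<bullet> [g, V] x)\<close> along extremals. Starting
  from the switching function \<open>p \<bullet> g x\<close>, the coefficient of \<open>u\<close> in its derivative of order \<open>l + 1\<close>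
  is therefore \<open>p \<bullet> [g, X\<^sub>l] x\<close> with \<open>X\<^sub>l = ad\<^sub>f\<^sup>l g\<close>
  (\<open>extremal_derivative_inner\<close>, \<open>switching_eq_inner_bracket\<close>).

  The claim is thus that the least \<open>l\<close> with \<open>[g, X\<^sub>l] \<noteq> 0\<close> is odd. This is forced by the Jacobi
  identity and antisymmetry: if \<open>[X\<^sub>0, X\<^sub>l]\<close> vanishes for all \<open>l < 2 m\<close>, then \<open>[X\<^sub>0, X\<^sub>2\<^sub>m]\<close> equals
  \<open>[X\<^sub>m, X\<^sub>m]\<close> up to sign, which is zero (\<open>even_iterated_bracket_vanishes\<close>). So the input first
  appears in a derivative of even order \<open>k\<close>, and \<open>k / 2\<close> is a positive integer.

  The Jacobi identity needs vector fields with symmetric second derivatives, and iterated brackets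
  need derivatives of all orders. Most of the work is to derive this from analyticity: a power
  series in several variables may be differentiated term by term near its centre
  (\<open>power_series_derivative\<close>), and second derivatives are symmetric by Young's theorem
  (\<open>second_derivative_symmetric_real\<close>).\<close>

section \<open>Functions with derivatives of all orders\<close>

text \<open>Differentiability of finite order is defined through directional derivatives, so that every
  iterated derivative has the same type as the function itself and all closure properties follow
  by induction on the order.\<close>

primrec times_differentiable ::
  "nat \<Rightarrow> ('a::real_normed_vector \<Rightarrow> 'b::real_normed_vector) \<Rightarrow> bool" where
  "times_differentiable 0 f \<longleftrightarrow> True"
| "times_differentiable (Suc n) f \<longleftrightarrow> (\<forall>x. f differentiable at x) \<and>
     (\<forall>v. times_differentiable n (\<lambda>x. frechet_derivative f (at x) v))"

definition smooth :: "('a::real_normed_vector \<Rightarrow> 'b::real_normed_vector) \<Rightarrow> bool" where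
  "smooth f \<longleftrightarrow> (\<forall>n. times_differentiable n f)"

lemma smooth_has_derivative:
  "smooth f \<Longrightarrow> (f has_derivative frechet_derivative f (at x)) (at x)"
  unfolding smooth_def using frechet_derivative_works times_differentiable.simps(2) by blast

lemma smooth_derivative: "smooth f \<Longrightarrow> smooth (\<lambda>x. frechet_derivative f (at x) v)"
  unfolding smooth_def using times_differentiable.simps(2) by blast

lemma times_differentiable_weaken: "times_differentiable (Suc n) f \<Longrightarrow> times_differentiable n f"
  by (induction n arbitrary: f) auto

text \<open>Lets a derivative found by differentiation rules stand in for \<open>frechet_derivative\<close>, so
  that each rule of differentiation below turns into a closure property.\<close>

lemma times_differentiable_SucI:
  assumes "\<And>x. (f has_derivative f' x) (at x)"
    and "\<And>v. times_differentiable n (\<lambda>x. f' x v)"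
  shows "times_differentiable (Suc n) f"
proof -
  have "frechet_derivative f (at x) = f' x" for x
    using frechet_derivative_at[OF assms(1)] by simp
  then show ?thesis
    using assms by (auto simp: differentiable_def)
qed

lemma times_differentiable_SucD:
  assumes "times_differentiable (Suc n) f"
  shows "(f has_derivative frechet_derivative f (at x)) (at x)"
    and "times_differentiable n (\<lambda>x. frechet_derivative f (at x) v)"
  using assms by (auto simp: frechet_derivative_works)

lemma times_differentiable_const: "times_differentiable n (\<lambda>_. c)"
proof (induction n arbitrary: c)
  case (Suc n)
  show ?case by (rule times_differentiable_SucI[OF has_derivative_const Suc.IH])
qed simp

lemma times_differentiable_add:
  "times_differentiable n f \<Longrightarrow> times_differentiable n g \<Longrightarrow> times_differentiable n (\<lambda>x. f x + g x)"
proof (induction n arbitrary: f g)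
  case (Suc n)
  show ?case
    by (rule times_differentiable_SucI[OF has_derivative_add])
      (use Suc times_differentiable_SucD in blast)+
qed simp

lemma times_differentiable_linear:
  assumes "bounded_linear h"
  shows "times_differentiable n f \<Longrightarrow> times_differentiable n (\<lambda>x. h (f x))"
proof (induction n arbitrary: f)
  case (Suc n)
  show ?case
    by (rule times_differentiable_SucI[OF bounded_linear.has_derivative[OF assms]])
      (use Suc times_differentiable_SucD in blast)+
qed simp

lemma times_differentiable_compose_linear:
  assumes "bounded_linear h"
  shows "times_differentiable n f \<Longrightarrow> times_differentiable n (\<lambda>x. f (h x))"
proof (induction n arbitrary: f)
  case (Suc n)
  have "((\<lambda>x. f (h x)) has_derivative (\<lambda>v. frechet_derivative f (at (h x)) (h v))) (at x)" for x
    using has_derivative_compose[OF bounded_linear_imp_has_derivative[OF assms]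
        times_differentiable_SucD(1)[OF Suc.prems]] .
  then show ?case
    by (rule times_differentiable_SucI) (use Suc times_differentiable_SucD(2) in blast)
qed simp

lemma times_differentiable_scaleR:
  "times_differentiable n f \<Longrightarrow> times_differentiable n g \<Longrightarrow>
    times_differentiable n (\<lambda>x. f x *\<^sub>R g x)"
proof (induction n arbitrary: f g)
  case (Suc n)
  note f = times_differentiable_SucD[OF Suc.prems(1)] times_differentiable_weaken[OF Suc.prems(1)]
  note g = times_differentiable_SucD[OF Suc.prems(2)] times_differentiable_weaken[OF Suc.prems(2)]
  show ?case
    by (rule times_differentiable_SucI[OF has_derivative_scaleR[OF f(1) g(1)]])
      (intro times_differentiable_add Suc.IH f g)
qed simp

lemma times_differentiable_sum:
  "(\<And>i. i \<in> I \<Longrightarrow> times_differentiable n (f i)) \<Longrightarrow> times_differentiable n (\<lambda>x. \<Sum>i\<in>I. f i x)"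
  by (induction I rule: infinite_finite_induct)
    (auto simp: times_differentiable_const times_differentiable_add)

lemma frechet_derivative_basis_expansion:
  fixes f :: "'a::euclidean_space \<Rightarrow> 'b::real_normed_vector"
  assumes "f differentiable at x"
  shows "frechet_derivative f (at x) v = (\<Sum>b\<in>Basis. (v \<bullet> b) *\<^sub>R frechet_derivative f (at x) b)"
proof -
  have L: "linear (frechet_derivative f (at x))"
    by (rule linear_frechet_derivative[OF assms])
  have "frechet_derivative f (at x) (\<Sum>b\<in>Basis. (v \<bullet> b) *\<^sub>R b) =
      (\<Sum>b\<in>Basis. (v \<bullet> b) *\<^sub>R frechet_derivative f (at x) b)"
    by (simp add: linear_sum[OF L] linear_cmul[OF L])
  then show ?thesis by (simp only: euclidean_representation)
qed

text \<open>The direction moves with the point, so the definition does not apply as it stands. Expanding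
  the direction in the standard basis reduces the claim to products of scalar functions with the
  derivatives in the fixed basis directions.\<close>

lemma times_differentiable_derivative_along:
  fixes f :: "'a::euclidean_space \<Rightarrow> 'b::real_normed_vector"
    and g :: "'a \<Rightarrow> 'a"
  assumes "times_differentiable (Suc n) f" "times_differentiable n g"
  shows "times_differentiable n (\<lambda>x. frechet_derivative f (at x) (g x))"
proof -
  have "(\<lambda>x. frechet_derivative f (at x) (g x)) =
      (\<lambda>x. \<Sum>b\<in>Basis. (g x \<bullet> b) *\<^sub>R frechet_derivative f (at x) b)"
    using assms(1) by (intro ext frechet_derivative_basis_expansion) simp
  moreover have "times_differentiable n (\<lambda>x. g x \<bullet> b)" for b
    by (rule times_differentiable_linear[OF bounded_linear_inner_left assms(2)])
  ultimately show ?thesis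
    using assms by (simp add: times_differentiable_sum times_differentiable_scaleR)
qed

lemma smooth_add: "smooth f \<Longrightarrow> smooth g \<Longrightarrow> smooth (\<lambda>x. f x + g x)"
  by (simp add: smooth_def times_differentiable_add)

lemma smooth_linear: "bounded_linear h \<Longrightarrow> smooth f \<Longrightarrow> smooth (\<lambda>x. h (f x))"
  by (simp add: smooth_def times_differentiable_linear)

lemma smooth_compose_linear: "bounded_linear h \<Longrightarrow> smooth f \<Longrightarrow> smooth (\<lambda>x. f (h x))"
  by (simp add: smooth_def times_differentiable_compose_linear)

lemma smooth_sum: "(\<And>i. i \<in> I \<Longrightarrow> smooth (f i)) \<Longrightarrow> smooth (\<lambda>x. \<Sum>i\<in>I. f i x)"
  by (simp add: smooth_def times_differentiable_sum)

lemma smooth_diff: "smooth f \<Longrightarrow> smooth g \<Longrightarrow> smooth (\<lambda>x. f x - g x)"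
  using smooth_add[of f "\<lambda>x. - g x"] smooth_linear[OF bounded_linear_minus[OF bounded_linear_ident], of g]
  by simp

lemma smooth_Pair: "smooth f \<Longrightarrow> smooth g \<Longrightarrow> smooth (\<lambda>x. (f x, g x))"
  using smooth_add[OF
      smooth_linear[OF bounded_linear_Pair[OF bounded_linear_ident bounded_linear_zero], of f]
      smooth_linear[OF bounded_linear_Pair[OF bounded_linear_zero bounded_linear_ident], of g]]
  by simp

lemma smooth_derivative_along:
  fixes f :: "'a::euclidean_space \<Rightarrow> 'b::real_normed_vector" and g :: "'a \<Rightarrow> 'a"
  shows "smooth f \<Longrightarrow> smooth g \<Longrightarrow> smooth (\<lambda>x. frechet_derivative f (at x) (g x))"
  unfolding smooth_def using times_differentiable_derivative_along by blast

section \<open>Symmetry of second derivatives\<close>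

text \<open>The step towards Young's theorem. The second difference is the increment over \<open>[0, t]\<close> of
  \<open>s \<mapsto> f (x + s v + t w) - f (x + s v)\<close>, so the mean value theorem turns it into \<open>t\<close> times a
  difference of two values of the derivative in direction \<open>v\<close>. Linearising that derivative
  at \<open>x\<close> makes the two contributions along \<open>v\<close> cancel, which leaves \<open>t\<^sup>2 g w\<close> up to a
  smaller error.\<close>

lemma second_difference_quotient_tendsto:
  fixes f :: "'a::real_normed_vector \<Rightarrow> real"
  assumes f: "\<And>y. (f has_derivative f' y) (at y)"
    and g: "((\<lambda>y. f' y v) has_derivative g) (at x)"
  shows "((\<lambda>t. (f (x + t *\<^sub>R v + t *\<^sub>R w) - f (x + t *\<^sub>R v) - f (x + t *\<^sub>R w) + f x) / t\<^sup>2)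
    \<longlongrightarrow> g w) (at_right 0)"
proof (rule tendstoI)
  fix e :: real assume e: "0 < e"
  define N where "N = norm v + norm w + 1"
  \<comment> \<open>Two linearisation errors of size \<open>\<epsilon> t N\<close> occur below; together they amount to \<open>t e / 2\<close>.\<close>
  define \<epsilon> where "\<epsilon> = e / (4 * N)"
  have N: "N > 0" and \<epsilon>: "\<epsilon> > 0" using e by (auto simp: N_def \<epsilon>_def add_nonneg_pos)
  interpret g: bounded_linear g using g by (rule has_derivative_bounded_linear)
  obtain d where d: "d > 0"
    and R: "\<And>y. norm (y - x) < d \<Longrightarrow> \<bar>f' y v - f' x v - g (y - x)\<bar> \<le> \<epsilon> * norm (y - x)"
    using g \<epsilon> unfolding has_derivative_at_alt real_norm_def by blast
  have "dist ((f (x + t *\<^sub>R v + t *\<^sub>R w) - f (x + t *\<^sub>R v) - f (x + t *\<^sub>R w) + f x) / t\<^sup>2) (g w) < e"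
    if t: "0 < t" "t < d / N" for t
  proof -
    have "\<exists>\<xi>>0. \<xi> < t \<and>
      (f (x + t *\<^sub>R v + t *\<^sub>R w) - f (x + t *\<^sub>R v)) - (f (x + 0 *\<^sub>R v + t *\<^sub>R w) - f (x + 0 *\<^sub>R v)) =
      (t - 0) * (f' (x + \<xi> *\<^sub>R v + t *\<^sub>R w) v - f' (x + \<xi> *\<^sub>R v) v)"
    proof (rule MVT2[OF t(1)])
      fix s :: real
      have 1: "((\<lambda>s. f (x + s *\<^sub>R v + t *\<^sub>R w)) has_derivative
          (\<lambda>h. f' (x + s *\<^sub>R v + t *\<^sub>R w) (h *\<^sub>R v))) (at s)"
        by (rule has_derivative_compose[OF _ f]) (auto intro!: derivative_eq_intros)
      have 2: "((\<lambda>s. f (x + s *\<^sub>R v)) has_derivative (\<lambda>h. f' (x + s *\<^sub>R v) (h *\<^sub>R v))) (at s)"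
        by (rule has_derivative_compose[OF _ f]) (auto intro!: derivative_eq_intros)
      have "f' y (h *\<^sub>R v) = f' y v * h" for y h
        using linear_cmul[OF has_derivative_linear[OF f]] by simp
      then show "((\<lambda>s. f (x + s *\<^sub>R v + t *\<^sub>R w) - f (x + s *\<^sub>R v)) has_real_derivative
          (f' (x + s *\<^sub>R v + t *\<^sub>R w) v - f' (x + s *\<^sub>R v) v)) (at s)"
        using has_derivative_diff[OF 1 2] by (simp add: has_field_derivative_def left_diff_distrib[symmetric] cong: if_cong)
    qed
    then obtain \<xi> where \<xi>: "0 < \<xi>" "\<xi> < t" and
      eq: "f (x + t *\<^sub>R v + t *\<^sub>R w) - f (x + t *\<^sub>R v) - f (x + t *\<^sub>R w) + f x =
        t * (f' (x + \<xi> *\<^sub>R v + t *\<^sub>R w) v - f' (x + \<xi> *\<^sub>R v) v)"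
      by (auto simp: algebra_simps)
    have small: "\<bar>f' (x + \<xi> *\<^sub>R v + s *\<^sub>R w) v - f' x v - g (\<xi> *\<^sub>R v + s *\<^sub>R w)\<bar> \<le> \<epsilon> * (t * N)"
      if s: "0 \<le> s" "s \<le> t" for s
    proof -
      have "norm (\<xi> *\<^sub>R v + s *\<^sub>R w) \<le> \<xi> * norm v + s * norm w"
        using \<xi> s by (metis abs_of_nonneg less_imp_le norm_scaleR norm_triangle_ineq)
      also have "\<dots> \<le> t * norm v + t * norm w"
        using \<xi> s by (intro add_mono mult_right_mono) auto
      finally have n: "norm (\<xi> *\<^sub>R v + s *\<^sub>R w) \<le> t * N"
        using t by (simp add: N_def distrib_left)
      also have "t * N < d" using t N by (simp add: pos_less_divide_eq)
      finally have "\<bar>f' (x + (\<xi> *\<^sub>R v + s *\<^sub>R w)) v - f' x v - g (\<xi> *\<^sub>R v + s *\<^sub>R w)\<bar>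
          \<le> \<epsilon> * norm (\<xi> *\<^sub>R v + s *\<^sub>R w)"
        using R[of "x + (\<xi> *\<^sub>R v + s *\<^sub>R w)"] by simp
      also have "\<dots> \<le> \<epsilon> * (t * N)" using n \<epsilon> by simp
      finally show ?thesis by (simp add: add.assoc)
    qed
    let ?D = "f' (x + \<xi> *\<^sub>R v + t *\<^sub>R w) v - f' (x + \<xi> *\<^sub>R v) v"
    have "\<bar>?D - t * g w\<bar> \<le> 2 * (\<epsilon> * (t * N))"
      using small[of t] small[of 0] t(1) by (simp add: g.add g.scaleR abs_le_iff)
    also have "\<dots> = t * (e / 2)" using N by (simp add: \<epsilon>_def)
    also have "\<dots> < t * e" using t e by simp
    finally have "\<bar>?D - t * g w\<bar> / t < e" using t by (simp add: pos_divide_less_eq mult.commute)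
    moreover have "(t * ?D) / t\<^sup>2 - g w = (?D - t * g w) / t"
      using t by (simp add: field_simps power2_eq_square)
    ultimately show ?thesis
      using t(1) unfolding eq dist_real_def by (simp add: abs_divide)
  qed
  then show "\<forall>\<^sub>F t in at_right 0. dist
      ((f (x + t *\<^sub>R v + t *\<^sub>R w) - f (x + t *\<^sub>R v) - f (x + t *\<^sub>R w) + f x) / t\<^sup>2) (g w) < e"
    using d N by (auto simp: eventually_at_right_field intro!: exI[of _ "d / N"])
qed

text \<open>The second difference is symmetric in \<open>v\<close> and \<open>w\<close>, and by the preceding lemma both mixed
  derivatives are its limit.\<close>

lemma second_derivative_symmetric_real:
  fixes f :: "'a::real_normed_vector \<Rightarrow> real"
  assumes "\<And>y. (f has_derivative f' y) (at y)"
    and "((\<lambda>y. f' y v) has_derivative g) (at x)"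
    and "((\<lambda>y. f' y w) has_derivative h) (at x)"
  shows "g w = h v"
proof -
  have "(\<lambda>t. (f (x + t *\<^sub>R v + t *\<^sub>R w) - f (x + t *\<^sub>R v) - f (x + t *\<^sub>R w) + f x) / t\<^sup>2) =
    (\<lambda>t. (f (x + t *\<^sub>R w + t *\<^sub>R v) - f (x + t *\<^sub>R w) - f (x + t *\<^sub>R v) + f x) / t\<^sup>2)"
    by (auto simp: algebra_simps)
  then show ?thesis
    using tendsto_unique[OF _ second_difference_quotient_tendsto[OF assms(1,2), of w]]
      second_difference_quotient_tendsto[OF assms(1,3), of v] by simp
qed

lemma smooth_second_derivative_symmetric:
  fixes f :: "'a::real_normed_vector \<Rightarrow> 'b::euclidean_space"
  assumes "smooth f"
  shows "frechet_derivative (\<lambda>y. frechet_derivative f (at y) v) (at x) w =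
    frechet_derivative (\<lambda>y. frechet_derivative f (at y) w) (at x) v"
proof (rule euclidean_eqI)
  fix b :: 'b
  note inner = bounded_linear.has_derivative[OF bounded_linear_inner_left, of _ _ _ b]
  note D = smooth_has_derivative[OF smooth_derivative[OF assms]]
  show "frechet_derivative (\<lambda>y. frechet_derivative f (at y) v) (at x) w \<bullet> b =
    frechet_derivative (\<lambda>y. frechet_derivative f (at y) w) (at x) v \<bullet> b"
    using second_derivative_symmetric_real[OF inner[OF smooth_has_derivative[OF assms]]
        inner[OF D] inner[OF D]] .
qed

section \<open>Lie brackets of vector fields\<close>

text \<open>The sign is chosen so that \<open>lie_bracket F\<close> is the operator that differentiation along the
  flow of \<open>F\<close> induces on \<open>G\<close> in the pairing \<open>p \<bullet> G x\<close>, when \<open>p\<close> evolves by the adjoint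
  equation.\<close>

definition lie_bracket :: "('a::euclidean_space \<Rightarrow> 'a) \<Rightarrow> ('a \<Rightarrow> 'a) \<Rightarrow> 'a \<Rightarrow> 'a" where
  "lie_bracket F G = (\<lambda>x. frechet_derivative G (at x) (F x) - frechet_derivative F (at x) (G x))"

lemma smooth_lie_bracket: "smooth F \<Longrightarrow> smooth G \<Longrightarrow> smooth (lie_bracket F G)"
  unfolding lie_bracket_def by (intro smooth_diff smooth_derivative_along)

lemma lie_bracket_zero: "smooth F \<Longrightarrow> lie_bracket F (\<lambda>_. 0) = (\<lambda>_. 0)"
  unfolding lie_bracket_def
  using linear_0[OF has_derivative_linear[OF smooth_has_derivative]] by fastforce

text \<open>The product rule for the derivative of \<open>F\<close> applied to \<open>G\<close>: one term from the motion of the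
  direction, one from the second derivative of \<open>F\<close>.\<close>

lemma has_derivative_derivative_along:
  fixes F :: "'a::euclidean_space \<Rightarrow> 'b::real_normed_vector" and G :: "'a \<Rightarrow> 'a"
  assumes F: "smooth F" and G: "smooth G"
  shows "((\<lambda>x. frechet_derivative F (at x) (G x)) has_derivative
    (\<lambda>w. frechet_derivative F (at x) (frechet_derivative G (at x) w) +
         frechet_derivative (\<lambda>y. frechet_derivative F (at y) (G x)) (at x) w)) (at x)"
proof -
  let ?D = "\<lambda>y. frechet_derivative F (at y)"
  let ?H = "\<lambda>b. frechet_derivative (\<lambda>y. ?D y b) (at x)"
  let ?G' = "frechet_derivative G (at x)"
  have expand: "?D y v = (\<Sum>b\<in>Basis. (v \<bullet> b) *\<^sub>R ?D y b)" for y v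
    using F by (intro frechet_derivative_basis_expansion) (meson smooth_has_derivative differentiable_def)
  have H: "((\<lambda>y. ?D y b) has_derivative ?H b) (at x)" for b
    by (intro smooth_has_derivative smooth_derivative F)
  have "((\<lambda>y. ?D y (G x)) has_derivative (\<lambda>w. \<Sum>b\<in>Basis. (G x \<bullet> b) *\<^sub>R ?H b w)) (at x)"
    by (subst expand) (intro derivative_intros H)
  then have HG: "?H (G x) w = (\<Sum>b\<in>Basis. (G x \<bullet> b) *\<^sub>R ?H b w)" for w
    by (rule frechet_derivative_at[THEN fun_cong, symmetric])
  have "((\<lambda>y. ?D y (G y)) has_derivative
      (\<lambda>w. \<Sum>b\<in>Basis. (G x \<bullet> b) *\<^sub>R ?H b w + (?G' w \<bullet> b) *\<^sub>R ?D x b)) (at x)"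
    by (subst expand)
      (intro has_derivative_sum has_derivative_scaleR H has_derivative_inner_left smooth_has_derivative G)
  moreover have "(\<Sum>b\<in>Basis. (G x \<bullet> b) *\<^sub>R ?H b w + (?G' w \<bullet> b) *\<^sub>R ?D x b) =
      ?D x (?G' w) + ?H (G x) w" for w
    unfolding sum.distrib HG by (subst (3) expand) (rule add.commute)
  ultimately show ?thesis by simp
qed

lemma frechet_derivative_lie_bracket:
  assumes "smooth F" "smooth G"
  shows "frechet_derivative (lie_bracket F G) (at x) w =
    frechet_derivative G (at x) (frechet_derivative F (at x) w) +
    frechet_derivative (\<lambda>y. frechet_derivative G (at y) (F x)) (at x) w -
    (frechet_derivative F (at x) (frechet_derivative G (at x) w) +
     frechet_derivative (\<lambda>y. frechet_derivative F (at y) (G x)) (at x) w)"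
proof -
  note D = has_derivative_diff[OF has_derivative_derivative_along[OF assms(2,1)]
      has_derivative_derivative_along[OF assms]]
  show ?thesis
    unfolding lie_bracket_def by (subst frechet_derivative_at[OF D, symmetric]) (rule refl)
qed

text \<open>The Jacobi identity, in the form that bracketing with \<open>F\<close> is a derivation of the bracket.
  Expanded, the products of first derivatives cancel identically, and the second derivatives
  cancel because they are symmetric.\<close>

lemma lie_bracket_derivation:
  assumes F: "smooth F" and G: "smooth G" and H: "smooth H"
  shows "lie_bracket F (lie_bracket G H) x =
    lie_bracket (lie_bracket F G) H x + lie_bracket G (lie_bracket F H) x"
proof -
  have lin: "frechet_derivative K (at x) (v - w) =
      frechet_derivative K (at x) v - frechet_derivative K (at x) w" if "smooth K" for K :: "'a \<Rightarrow> 'a" and v w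
    using linear_diff[OF has_derivative_linear[OF smooth_has_derivative[OF that]]] .
  have "frechet_derivative (\<lambda>y. frechet_derivative K (at y) v) (at x) w =
      frechet_derivative (\<lambda>y. frechet_derivative K (at y) w) (at x) v" if "smooth K" for K :: "'a \<Rightarrow> 'a" and v w
    using smooth_second_derivative_symmetric[OF that] .
  note sym = this[OF F, of "H x" "G x"] this[OF G, of "H x" "F x"] this[OF H, of "G x" "F x"]
  have unf: "lie_bracket A B x = frechet_derivative B (at x) (A x) - frechet_derivative A (at x) (B x)" for A B :: "'a \<Rightarrow> 'a"
    by (simp add: lie_bracket_def)
  show ?thesis
    unfolding unf frechet_derivative_lie_bracket[OF F G] frechet_derivative_lie_bracket[OF F H]
      frechet_derivative_lie_bracket[OF G H] lin[OF F] lin[OF G] lin[OF H] sym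
    by (simp add: algebra_simps)
qed

text \<open>The parity argument. Write \<open>X\<^sub>l\<close> for the \<open>l\<close>-fold bracket of \<open>G\<close> with \<open>F\<close>. By the Jacobi identity
  bracketing \<open>[X\<^sub>i, X\<^sub>j]\<close> with \<open>F\<close> gives \<open>[X\<^sub>i\<^sub>+\<^sub>1, X\<^sub>j] + [X\<^sub>i, X\<^sub>j\<^sub>+\<^sub>1]\<close>. So the vanishing of
  \<open>[X\<^sub>0, X\<^sub>l]\<close> for \<open>l < 2 m\<close> spreads to all \<open>[X\<^sub>i, X\<^sub>j]\<close> with \<open>i + j < 2 m\<close>, and on the
  diagonal \<open>i + j = 2 m\<close> the brackets agree up to alternating sign. That diagonal contains
  \<open>[X\<^sub>m, X\<^sub>m] = 0\<close>, hence \<open>[X\<^sub>0, X\<^sub>2\<^sub>m]\<close> vanishes as well.\<close>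

lemma even_iterated_bracket_vanishes:
  fixes F G :: "'a::euclidean_space \<Rightarrow> 'a"
  defines "X \<equiv> \<lambda>l. (lie_bracket F ^^ l) G"
  assumes F: "smooth F" and G: "smooth G"
    and zero: "\<And>l. l < 2 * m \<Longrightarrow> lie_bracket G (X l) = (\<lambda>_. 0)"
  shows "lie_bracket G (X (2 * m)) = (\<lambda>_. 0)"
proof
  fix x
  have X: "smooth (X l)" for l
    unfolding X_def by (induction l) (simp_all add: F G smooth_lie_bracket)
  have X_Suc: "lie_bracket F (X l) = X (Suc l)" for l
    by (simp add: X_def)
  have deriv: "lie_bracket (X (Suc i)) (X j) y = lie_bracket F (lie_bracket (X i) (X j)) y -
      lie_bracket (X i) (X (Suc j)) y" for i j y
    using lie_bracket_derivation[OF F X X, of i j] by (simp add: X_Suc)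
  have low: "lie_bracket (X i) (X j) = (\<lambda>_. 0)" if "i + j < 2 * m" for i j
    using that
  proof (induction i arbitrary: j)
    case 0
    then show ?case using zero by (simp add: X_def)
  next
    case (Suc i)
    then show ?case by (intro ext) (simp add: deriv lie_bracket_zero F)
  qed
  have "lie_bracket (X i) (X (2 * m - i)) x = (- 1) ^ i *\<^sub>R lie_bracket G (X (2 * m)) x"
    if "i \<le> 2 * m" for i
    using that
  proof (induction i)
    case 0
    then show ?case by (simp add: X_def)
  next
    case (Suc i)
    then have "Suc (2 * m - Suc i) = 2 * m - i" "i + (2 * m - Suc i) < 2 * m" by auto
    then show ?case using Suc by (simp add: deriv low lie_bracket_zero F)
  qed
  from this[of m] have "lie_bracket (X m) (X m) x = (- 1) ^ m *\<^sub>R lie_bracket G (X (2 * m)) x"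
    by (simp add: mult_2)
  then show "lie_bracket G (X (2 * m)) x = 0"
    by (simp add: lie_bracket_def)
qed



section \<open>Real analytic functions are smooth\<close>

lemma has_sum_diff:
  fixes f g :: "'i \<Rightarrow> 'a::real_normed_vector"
  assumes "(f has_sum a) I" "(g has_sum b) I"
  shows "((\<lambda>i. f i - g i) has_sum (a - b)) I"
  using has_sum_add[OF assms(1), of "\<lambda>i. - g i" "- b"] assms(2) by (simp add: has_sum_uminus)

text \<open>Termwise differentiation of an unconditional sum, with a summable bound \<open>M\<close> for the
  derivatives of the terms. Outside a finite set of indices that carries almost all of the
  sum of \<open>M\<close>, both the increments of the terms (by the mean value inequality) and their linear
  approximations are at most a small multiple of the distance; the finitely many remaining terms
  are differentiable.\<close>

lemma has_derivative_has_sum: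
  fixes f :: "'i \<Rightarrow> 'a::real_normed_vector \<Rightarrow> 'b::banach"
  assumes S: "open S" "convex S"
    and f: "\<And>i y. i \<in> I \<Longrightarrow> y \<in> S \<Longrightarrow> (f i has_derivative f' i y) (at y)"
    and bound: "\<And>i y h. i \<in> I \<Longrightarrow> y \<in> S \<Longrightarrow> norm (f' i y h) \<le> M i * norm h"
    and M: "M summable_on I"
    and F: "\<And>y. y \<in> S \<Longrightarrow> ((\<lambda>i. f i y) has_sum F y) I"
    and x: "x \<in> S"
  shows "(F has_derivative (\<lambda>h. \<Sum>\<^sub>\<infinity>i\<in>I. f' i x h)) (at x)"
proof -
  let ?L = "\<lambda>h. \<Sum>\<^sub>\<infinity>i\<in>I. f' i x h"
  have Mh: "((\<lambda>i. M i * norm h) has_sum (infsum M I * norm h)) I" for h :: 'a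
    by (intro has_sum_cmult_left has_sum_infsum M)
  have L: "((\<lambda>i. f' i x h) has_sum ?L h) I" for h
  proof -
    have "(\<lambda>i. norm (f' i x h)) summable_on I"
      by (rule Infinite_Sum.abs_summable_on_comparison_test'[OF has_sum_imp_summable[OF Mh[of h]]]) (rule bound[OF _ x])
    then show ?thesis by (rule has_sum_infsum[OF abs_summable_summable])
  qed
  have linear: "linear (f' i x)" if "i \<in> I" for i
    using f[OF that x] by (rule has_derivative_linear)
  have "bounded_linear ?L"
  proof (rule bounded_linear_intro[where K = "infsum M I"])
    fix g h :: 'a and c :: real
    have "((\<lambda>i. f' i x (g + h)) has_sum ?L g + ?L h) I"
      using has_sum_add[OF L L] by (subst has_sum_cong[OF linear_add[OF linear]])
    then show "?L (g + h) = ?L g + ?L h" by (rule infsumI)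
    have "((\<lambda>i. f' i x (c *\<^sub>R h)) has_sum c *\<^sub>R ?L h) I"
      using has_sum_scaleR[OF L] by (subst has_sum_cong[OF linear_cmul[OF linear]])
    then show "?L (c *\<^sub>R h) = c *\<^sub>R ?L h" by (rule infsumI)
    show "norm (?L h) \<le> norm h * infsum M I"
      using norm_infsum_le[OF L Mh bound[OF _ x]] by (simp add: mult.commute)
  qed
  moreover have "\<exists>d>0. \<forall>y. norm (y - x) < d \<longrightarrow> norm (F y - F x - ?L (y - x)) \<le> e * norm (y - x)"
    if e: "e > 0" for e
  proof -
    obtain T where T: "finite T" "T \<subseteq> I" and "\<bar>sum M T - infsum M I\<bar> < e / 3"
      using tendstoD[OF has_sum_infsum[OF M, unfolded has_sum_def], of "e / 3"] e
      by (auto simp: eventually_finite_subsets_at_top dist_real_def)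
    then have tail: "infsum M I - sum M T \<le> e / 3" by linarith
    have "((\<lambda>y. \<Sum>i\<in>T. f i y) has_derivative (\<lambda>h. \<Sum>i\<in>T. f' i x h)) (at x)"
      using T x f by (intro has_derivative_sum) auto
    then obtain d1 where d1: "d1 > 0" and T_close: "\<And>y. norm (y - x) < d1 \<Longrightarrow>
        norm ((\<Sum>i\<in>T. f i y) - (\<Sum>i\<in>T. f i x) - (\<Sum>i\<in>T. f' i x (y - x))) \<le> e / 3 * norm (y - x)"
      using e unfolding has_derivative_at_alt by (metis divide_pos_pos zero_less_numeral)
    obtain d2 where d2: "d2 > 0" "ball x d2 \<subseteq> S"
      using S x open_contains_ball by blast
    have "norm (F y - F x - ?L (y - x)) \<le> e * norm (y - x)" if y: "norm (y - x) < min d1 d2" for y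
    proof -
      let ?D = "\<lambda>i. f i y - f i x - f' i x (y - x)"
      have yS: "y \<in> S" using y d2 by (auto simp: dist_norm norm_minus_commute)
      have D_le: "norm (?D i) \<le> 2 * norm (y - x) * M i" if i: "i \<in> I" for i
      proof -
        have "norm (f i y - f i x) \<le> M i * norm (y - x)"
        proof (cases "y = x")
          case False
          then have "0 \<le> M i"
            using order_trans[OF norm_ge_zero bound[OF i x, of "y - x"]] by (simp add: zero_le_mult_iff)
          then have "onorm (f' i z) \<le> M i" if "z \<in> S" for z
            by (rule onorm_bound) (rule bound[OF i that])
          then show ?thesis
            using has_derivative_at_withinI[OF f[OF i]] yS x by (intro differentiable_bound[OF S(2)])
        qed simp
        moreover have "2 * norm (y - x) * M i = M i * norm (y - x) + M i * norm (y - x)" by simp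
        ultimately show ?thesis
          using bound[OF i x, of "y - x"] norm_triangle_ineq4[of "f i y - f i x" "f' i x (y - x)"]
          by linarith
      qed
      have "(?D has_sum (F y - F x - ?L (y - x))) I"
        by (intro has_sum_diff F yS x L)
      then have "(?D has_sum (F y - F x - ?L (y - x) - sum ?D T)) (I - T)"
        using T by (intro has_sum_Diff has_sum_finite)
      moreover have "((\<lambda>i. 2 * norm (y - x) * M i) has_sum 2 * norm (y - x) * (infsum M I - sum M T)) (I - T)"
        using T by (intro has_sum_cmult_right has_sum_Diff has_sum_infsum M has_sum_finite)
      ultimately have "norm (F y - F x - ?L (y - x) - sum ?D T) \<le> 2 * norm (y - x) * (infsum M I - sum M T)"
        by (rule norm_infsum_le) (simp add: D_le)
      also have "\<dots> \<le> 2 * norm (y - x) * (e / 3)"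
        using tail by (intro mult_left_mono) auto
      finally have "norm (F y - F x - ?L (y - x) - sum ?D T) \<le> 2 * norm (y - x) * (e / 3)" .
      moreover have "norm (sum ?D T) \<le> e / 3 * norm (y - x)"
        using T_close[of y] y by (simp add: sum_subtractf)
      moreover have "2 * norm (y - x) * (e / 3) + e / 3 * norm (y - x) = e * norm (y - x)" by simp
      ultimately show ?thesis
        using norm_triangle_sub[of "F y - F x - ?L (y - x)" "sum ?D T"] by linarith
    qed
    then show ?thesis using d1 d2 by (intro exI[of _ "min d1 d2"]) auto
  qed
  ultimately show ?thesis unfolding has_derivative_at_alt by blast
qed

definition multi_power :: "('a::euclidean_space \<Rightarrow> nat) \<Rightarrow> 'a \<Rightarrow> real" where
  "multi_power \<alpha> z = (\<Prod>b\<in>Basis. (z \<bullet> b) ^ \<alpha> b)"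

text \<open>Truncated subtraction leaves a zero exponent at zero. This is harmless because in a
  derivative the monomial then carries the factor zero.\<close>

definition lower_exponent :: "'a \<Rightarrow> ('a \<Rightarrow> nat) \<Rightarrow> 'a \<Rightarrow> nat" where
  "lower_exponent b \<alpha> = \<alpha>(b := \<alpha> b - 1)"

lemma has_derivative_multi_power:
  "(multi_power \<alpha> has_derivative
    (\<lambda>h. \<Sum>b\<in>Basis. (h \<bullet> b) * (real (\<alpha> b) * multi_power (lower_exponent b \<alpha>) z))) (at z)"
proof -
  have *: "(h \<bullet> b) * (real (\<alpha> b) * multi_power (lower_exponent b \<alpha>) z) =
    real (\<alpha> b) * (h \<bullet> b) * (z \<bullet> b) ^ (\<alpha> b - 1) * (\<Prod>j\<in>Basis - {b}. (z \<bullet> j) ^ \<alpha> j)"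
    if "b \<in> Basis" for b h
    unfolding multi_power_def by (subst prod.remove[OF finite_Basis that]) (simp add: lower_exponent_def)
  have "((\<lambda>y. \<Prod>b\<in>Basis. (y \<bullet> b) ^ \<alpha> b) has_derivative
    (\<lambda>h. \<Sum>b\<in>Basis. real (\<alpha> b) * (h \<bullet> b) * (z \<bullet> b) ^ (\<alpha> b - 1) *
      (\<Prod>j\<in>Basis - {b}. (z \<bullet> j) ^ \<alpha> j))) (at z)"
    by (intro has_derivative_prod has_derivative_power has_derivative_inner_left has_derivative_ident)
  moreover have "multi_power \<alpha> = (\<lambda>y. \<Prod>b\<in>Basis. (y \<bullet> b) ^ \<alpha> b)"
    by (simp add: multi_power_def fun_eq_iff)
  ultimately show ?thesis
    by (simp add: * cong: sum.cong)
qed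

text \<open>Cauchy's estimate for a partial derivative of a monomial. On half the polyradius the
  differentiated monomial gains a factor \<open>2\<close> to the power \<open>1 - \<alpha> b\<close>, which absorbs the factor
  \<open>\<alpha> b\<close>. So the original series at the point with all coordinates \<open>s\<close> majorises the
  differentiated one.\<close>

lemma lowered_multi_power_bound:
  fixes z :: "'a::euclidean_space"
  assumes s: "s > 0" and z: "norm z \<le> s / 2" and b: "b \<in> Basis"
  shows "\<bar>real (\<alpha> b) * multi_power (lower_exponent b \<alpha>) z\<bar> \<le> 2 / s * multi_power \<alpha> (s *\<^sub>R One)"
proof (cases "\<alpha> b = 0")
  case True
  then show ?thesis using s by (simp add: multi_power_def prod_nonneg)
next
  case False
  have "\<bar>multi_power (lower_exponent b \<alpha>) z\<bar> \<le> (\<Prod>j\<in>Basis. (s / 2) ^ lower_exponent b \<alpha> j)"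
    unfolding multi_power_def abs_prod power_abs
    using z by (intro prod_mono conjI power_mono zero_le_power abs_ge_zero) (metis Basis_le_norm order_trans)
  also have "\<dots> = (s / 2) ^ (\<alpha> b - 1) * (\<Prod>j\<in>Basis - {b}. (s / 2) ^ \<alpha> j)"
    by (subst prod.remove[OF finite_Basis b]) (simp add: lower_exponent_def)
  also have "\<dots> \<le> (s / 2) ^ (\<alpha> b - 1) * (\<Prod>j\<in>Basis - {b}. s ^ \<alpha> j)"
    using s by (intro mult_left_mono prod_mono conjI power_mono) auto
  finally have "\<bar>real (\<alpha> b) * multi_power (lower_exponent b \<alpha>) z\<bar> \<le>
      real (\<alpha> b) * ((s / 2) ^ (\<alpha> b - 1) * (\<Prod>j\<in>Basis - {b}. s ^ \<alpha> j))"
    by (simp add: abs_mult mult_left_mono)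
  also have "real (\<alpha> b) * (s / 2) ^ (\<alpha> b - 1) \<le> 2 / s * s ^ \<alpha> b"
  proof -
    obtain k where k: "\<alpha> b = Suc k" using False not0_implies_Suc by blast
    have "real (Suc k) \<le> 2 ^ Suc k" using of_nat_less_two_power[of "Suc k", where 'a = real] by linarith
    then have "real (Suc k) * s ^ k \<le> 2 ^ Suc k * s ^ k"
      using s by (intro mult_right_mono) auto
    then show ?thesis using s by (simp add: k power_divide field_simps)
  qed
  then have "real (\<alpha> b) * ((s / 2) ^ (\<alpha> b - 1) * (\<Prod>j\<in>Basis - {b}. s ^ \<alpha> j)) \<le>
      2 / s * s ^ \<alpha> b * (\<Prod>j\<in>Basis - {b}. s ^ \<alpha> j)"
    unfolding mult.assoc[symmetric] using s by (intro mult_right_mono prod_nonneg) auto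
  also have "\<dots> = 2 / s * multi_power \<alpha> (s *\<^sub>R One)"
    unfolding multi_power_def
    by (subst prod.remove[OF finite_Basis b]) (simp add: b)
  finally show ?thesis .
qed

text \<open>Puts a formally differentiated power series back into standard form: the terms with
  \<open>\<alpha> b = 0\<close> vanish, and raising the exponent at \<open>b\<close> parametrises the others.\<close>

lemma lowered_series_reindex:
  fixes c :: "('a::euclidean_space \<Rightarrow> nat) \<Rightarrow> real"
  assumes b: "b \<in> Basis"
  shows "((\<lambda>\<alpha>. real (\<alpha> b) * multi_power (lower_exponent b \<alpha>) z * c \<alpha>) has_sum l) (Basis \<rightarrow>\<^sub>E UNIV) \<longleftrightarrow>
    ((\<lambda>\<beta>. multi_power \<beta> z * (real (Suc (\<beta> b)) * c (\<beta>(b := Suc (\<beta> b))))) has_sum l) (Basis \<rightarrow>\<^sub>E UNIV)"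
    (is "(?f has_sum l) ?I \<longleftrightarrow> (?g has_sum l) ?I")
proof -
  let ?up = "\<lambda>\<beta>. \<beta>(b := Suc (\<beta> b))"
  have "bij_betw ?up ?I {\<alpha> \<in> ?I. \<alpha> b \<noteq> 0}"
    by (rule bij_betw_byWitness[where f' = "lower_exponent b"])
      (use b in \<open>auto simp: lower_exponent_def PiE_iff extensional_def fun_eq_iff\<close>)
  then have "((\<lambda>\<beta>. ?f (?up \<beta>)) has_sum l) ?I \<longleftrightarrow> (?f has_sum l) {\<alpha> \<in> ?I. \<alpha> b \<noteq> 0}"
    by (rule has_sum_reindex_bij_betw)
  moreover have "(\<lambda>\<beta>. ?f (?up \<beta>)) = ?g"
    by (simp add: lower_exponent_def fun_eq_iff)
  moreover have "(?f has_sum l) {\<alpha> \<in> ?I. \<alpha> b \<noteq> 0} \<longleftrightarrow> (?f has_sum l) ?I"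
    by (rule has_sum_cong_neutral) auto
  ultimately show ?thesis by simp
qed

text \<open>A real series that sums unconditionally sums absolutely. At the point whose coordinates
  relative to \<open>a\<close> all equal a small \<open>s\<close>, this yields by the monomial estimate a summable bound for all
  partial derivatives on a smaller ball about \<open>a\<close>. There each partial derivative is again a power
  series centred at \<open>a\<close>, which is what its analyticity at \<open>a\<close> asks for.\<close>

lemma power_series_derivative:
  fixes f :: "'a::euclidean_space \<Rightarrow> real" and c :: "('a \<Rightarrow> nat) \<Rightarrow> real"
  assumes r: "r > 0"
    and f: "\<And>y. dist y a < r \<Longrightarrow> ((\<lambda>\<alpha>. multi_power \<alpha> (y - a) * c \<alpha>) has_sum f y) (Basis \<rightarrow>\<^sub>E UNIV)"
  obtains \<rho> f' where "\<rho> > 0" and "\<And>y. dist y a < \<rho> \<Longrightarrow> (f has_derivative f' y) (at y)"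
    and "\<And>y b. dist y a < \<rho> \<Longrightarrow> b \<in> Basis \<Longrightarrow>
      ((\<lambda>\<beta>. multi_power \<beta> (y - a) * (real (Suc (\<beta> b)) * c (\<beta>(b := Suc (\<beta> b))))) has_sum f' y b)
        (Basis \<rightarrow>\<^sub>E UNIV)"
proof -
  let ?I = "Basis \<rightarrow>\<^sub>E UNIV :: ('a \<Rightarrow> nat) set"
  \<comment> \<open>The point \<open>a + s One\<close> lies at distance \<open>r / 2\<close> from \<open>a\<close>.\<close>
  define s where "s = r / (2 * norm (One :: 'a))"
  define \<rho> where "\<rho> = min r (s / 2)"
  have One: "norm (One :: 'a) > 0" by simp
  have s: "s > 0" using r One unfolding s_def by (intro divide_pos_pos mult_pos_pos) auto
  have "dist (a + s *\<^sub>R One) a < r"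
    using r One by (simp add: dist_norm s_def)
  from f[OF this] have "(\<lambda>\<alpha>. multi_power \<alpha> (s *\<^sub>R One) * c \<alpha>) summable_on ?I"
    by (simp add: has_sum_imp_summable)
  then have "(\<lambda>\<alpha>. \<bar>multi_power \<alpha> (s *\<^sub>R One) * c \<alpha>\<bar>) summable_on ?I"
    using summable_on_iff_abs_summable_on_real[THEN iffD1] by fastforce
  moreover have pos: "multi_power \<alpha> (s *\<^sub>R One) \<ge> 0" for \<alpha> :: "'a \<Rightarrow> nat"
    using s by (auto simp: multi_power_def intro!: prod_nonneg)
  ultimately have "(\<lambda>\<alpha>. multi_power \<alpha> (s *\<^sub>R One) * \<bar>c \<alpha>\<bar>) summable_on ?I"
    by (simp add: abs_mult)
  then have M: "(\<lambda>\<alpha>. real DIM('a) * (2 / s) * (multi_power \<alpha> (s *\<^sub>R One) * \<bar>c \<alpha>\<bar>)) summable_on ?I"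
    by (rule summable_on_cmult_right)
  let ?term' = "\<lambda>\<alpha> y h. (\<Sum>b\<in>Basis. (h \<bullet> b) * (real (\<alpha> b) * multi_power (lower_exponent b \<alpha>) (y - a))) * c \<alpha>"
  have term': "((\<lambda>y. multi_power \<alpha> (y - a) * c \<alpha>) has_derivative ?term' \<alpha> y) (at y)" for \<alpha> y
    by (intro has_derivative_mult_left has_derivative_compose[OF _ has_derivative_multi_power, where f = "\<lambda>y. y - a"])
      (auto intro!: derivative_eq_intros)
  have bound: "norm (?term' \<alpha> y h) \<le>
      real DIM('a) * (2 / s) * (multi_power \<alpha> (s *\<^sub>R One) * \<bar>c \<alpha>\<bar>) * norm h"
    if y: "y \<in> ball a \<rho>" for \<alpha> y h
  proof -
    have "norm (y - a) \<le> s / 2" using y by (simp add: \<rho>_def dist_norm norm_minus_commute)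
    then have "\<bar>(h \<bullet> b) * (real (\<alpha> b) * multi_power (lower_exponent b \<alpha>) (y - a))\<bar> \<le>
        norm h * (2 / s * multi_power \<alpha> (s *\<^sub>R One))" if "b \<in> Basis" for b
      unfolding abs_mult[of "h \<bullet> b"]
      using that s by (intro mult_mono lowered_multi_power_bound Basis_le_norm) auto
    then have "\<bar>\<Sum>b\<in>Basis. (h \<bullet> b) * (real (\<alpha> b) * multi_power (lower_exponent b \<alpha>) (y - a))\<bar> \<le>
        real DIM('a) * (norm h * (2 / s * multi_power \<alpha> (s *\<^sub>R One)))"
      by (intro order_trans[OF sum_abs] sum_bounded_above)
    then have "\<bar>\<Sum>b\<in>Basis. (h \<bullet> b) * (real (\<alpha> b) * multi_power (lower_exponent b \<alpha>) (y - a))\<bar> * \<bar>c \<alpha>\<bar> \<le>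
        real DIM('a) * (norm h * (2 / s * multi_power \<alpha> (s *\<^sub>R One))) * \<bar>c \<alpha>\<bar>"
      by (rule mult_right_mono) simp
    then show ?thesis by (simp add: abs_mult mult_ac)
  qed
  let ?f' = "\<lambda>y h. \<Sum>\<^sub>\<infinity>\<alpha>\<in>?I. ?term' \<alpha> y h"
  have "\<rho> > 0" using r s by (simp add: \<rho>_def)
  moreover have "(f has_derivative ?f' y) (at y)" if "dist y a < \<rho>" for y
    by (rule has_derivative_has_sum[where S = "ball a \<rho>", OF open_ball convex_ball term' bound M])
      (use that in \<open>auto simp: \<rho>_def dist_commute intro!: f\<close>)
  moreover have "((\<lambda>\<beta>. multi_power \<beta> (y - a) * (real (Suc (\<beta> b)) * c (\<beta>(b := Suc (\<beta> b)))))
      has_sum ?f' y b) ?I" if y: "dist y a < \<rho>" and b: "b \<in> Basis" for y b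
  proof -
    have eq: "?term' \<alpha> y b = real (\<alpha> b) * multi_power (lower_exponent b \<alpha>) (y - a) * c \<alpha>" for \<alpha>
      using b by (simp add: inner_Basis if_distrib[where f = "\<lambda>u. u * _"] sum.delta cong: if_cong)
    have "(\<lambda>\<alpha>. norm (?term' \<alpha> y b)) summable_on ?I"
      by (rule Infinite_Sum.abs_summable_on_comparison_test'[OF summable_on_cmult_left[OF M, of "norm b"]])
        (rule bound, use y in \<open>simp add: dist_commute\<close>)
    then have "((\<lambda>\<alpha>. ?term' \<alpha> y b) has_sum ?f' y b) ?I"
      by (rule has_sum_infsum[OF abs_summable_summable])
    then have "((\<lambda>\<alpha>. real (\<alpha> b) * multi_power (lower_exponent b \<alpha>) (y - a) * c \<alpha>) has_sum ?f' y b) ?I"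
      by (rule has_sum_cong[THEN iffD1, rotated]) (rule eq)
    then show ?thesis by (rule lowered_series_reindex[OF b, THEN iffD1])
  qed
  ultimately show ?thesis by (rule that[where f' = ?f'])
qed

lemma real_analytic_derivative:
  fixes f :: "'a::euclidean_space \<Rightarrow> real"
  assumes "f real_analytic_on UNIV"
  shows "f differentiable at x"
    and "b \<in> Basis \<Longrightarrow> (\<lambda>y. frechet_derivative f (at y) b) real_analytic_on UNIV"
proof -
  have expansion: thesis
    if "\<And>\<rho> f' c. \<lbrakk>0 < \<rho>; \<And>y. dist y a < \<rho> \<Longrightarrow> (f has_derivative f' y) (at y);
      \<And>y b. \<lbrakk>dist y a < \<rho>; b \<in> Basis\<rbrakk> \<Longrightarrow>
        ((\<lambda>\<alpha>. multi_power \<alpha> (y - a) * c b \<alpha>) has_sum f' y b) (Basis \<rightarrow>\<^sub>E UNIV)\<rbrakk> \<Longrightarrow> thesis"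
    for a thesis
  proof -
    obtain c r where "r > 0" and "\<And>y. dist y a < r \<Longrightarrow>
        ((\<lambda>\<alpha>. multi_power \<alpha> (y - a) * c \<alpha>) has_sum f y) (Basis \<rightarrow>\<^sub>E UNIV)"
      using assms unfolding real_analytic_on_def multi_power_def real_scaleR_def by (meson UNIV_I)
    from power_series_derivative[OF this] show thesis
      using that[where c = "\<lambda>b \<beta>. real (Suc (\<beta> b)) * c (\<beta>(b := Suc (\<beta> b)))"] by blast
  qed
  show "f differentiable at x"
    by (rule expansion[of x]) (metis differentiable_def dist_self)
  show "(\<lambda>y. frechet_derivative f (at y) b) real_analytic_on UNIV" if b: "b \<in> Basis"
    unfolding real_analytic_on_def
  proof
    fix a :: 'a
    obtain \<rho> f' c where \<rho>: "0 < \<rho>" and f': "\<And>y. dist y a < \<rho> \<Longrightarrow> (f has_derivative f' y) (at y)"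
      and c: "\<And>y b. dist y a < \<rho> \<Longrightarrow> b \<in> Basis \<Longrightarrow>
        ((\<lambda>\<alpha>. multi_power \<alpha> (y - a) * c b \<alpha>) has_sum f' y b) (Basis \<rightarrow>\<^sub>E UNIV)"
      by (rule expansion[of a]) blast
    have "frechet_derivative f (at y) = f' y" if "dist y a < \<rho>" for y
      using frechet_derivative_at[OF f'[OF that]] by simp
    then show "\<exists>c r. 0 < r \<and> (\<forall>y\<in>UNIV. dist y a < r \<longrightarrow>
       ((\<lambda>\<alpha>. (\<Prod>b\<in>Basis. ((y - a) \<bullet> b) ^ \<alpha> b) *\<^sub>R c \<alpha>) has_sum frechet_derivative f (at y) b)
         (Basis \<rightarrow>\<^sub>E UNIV))"
      using \<rho> c[OF _ b] by (intro exI[of _ "c b"] exI[of _ \<rho>]) (simp add: multi_power_def)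
  qed
qed

text \<open>Partial derivatives of analytic functions are analytic, so the induction on the order never
  leaves the class; other directional derivatives are linear combinations of these.\<close>

lemma real_analytic_imp_smooth_real:
  fixes f :: "'a::euclidean_space \<Rightarrow> real"
  assumes "f real_analytic_on UNIV"
  shows "smooth f"
proof -
  have "times_differentiable n f" for n
    using assms
  proof (induction n arbitrary: f)
    case (Suc n)
    note diff = real_analytic_derivative(1)[OF Suc.prems]
    have "times_differentiable n (\<lambda>x. \<Sum>b\<in>Basis. (v \<bullet> b) *\<^sub>R frechet_derivative f (at x) b)" for v
      by (intro times_differentiable_sum times_differentiable_scaleR times_differentiable_const
          Suc.IH real_analytic_derivative(2) Suc.prems)
    then show ?case
      unfolding times_differentiable.simps frechet_derivative_basis_expansion[OF diff, symmetric]
      using diff by blast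
  qed simp
  then show ?thesis by (simp add: smooth_def)
qed

lemma real_analytic_imp_smooth:
  fixes f :: "'a::euclidean_space \<Rightarrow> 'b::euclidean_space"
  assumes "f real_analytic_on UNIV"
  shows "smooth f"
proof -
  have "(\<lambda>x. f x \<bullet> b) real_analytic_on UNIV" for b
    unfolding real_analytic_on_def
  proof
    fix a :: 'a
    obtain c r where "0 < r" and "\<And>y. dist y a < r \<Longrightarrow>
        ((\<lambda>\<alpha>. (\<Prod>b\<in>Basis. ((y - a) \<bullet> b) ^ \<alpha> b) *\<^sub>R c \<alpha>) has_sum f y) (Basis \<rightarrow>\<^sub>E UNIV)"
      using assms unfolding real_analytic_on_def by (metis UNIV_I)
    then show "\<exists>c r. 0 < r \<and> (\<forall>y\<in>UNIV. dist y a < r \<longrightarrow>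
        ((\<lambda>\<alpha>. (\<Prod>b\<in>Basis. ((y - a) \<bullet> b) ^ \<alpha> b) *\<^sub>R c \<alpha>) has_sum f y \<bullet> b) (Basis \<rightarrow>\<^sub>E UNIV))"
      using has_sum_bounded_linear[OF bounded_linear_inner_left[of b]]
      by (intro exI[of _ "\<lambda>\<alpha>. c \<alpha> \<bullet> b"] exI[of _ r]) (force simp: inner_scaleR_left)
  qed
  then have "smooth (\<lambda>x. \<Sum>b\<in>Basis. (f x \<bullet> b) *\<^sub>R b)"
    by (intro smooth_sum smooth_linear[OF bounded_linear_scaleR_left] real_analytic_imp_smooth_real)
  then show ?thesis by (simp add: euclidean_representation)
qed

section \<open>The switching function and its time derivatives\<close>

lemma smooth_aug_fields:
  assumes "analytic_problem P"
  shows "smooth (aug_drift P)" "smooth (aug_input P)"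
proof -
  note lift = smooth_compose_linear[OF bounded_linear_snd real_analytic_imp_smooth]
  show "smooth (aug_drift P)" "smooth (aug_input P)"
    using assms unfolding analytic_problem_def aug_drift_def[abs_def] aug_input_def[abs_def]
    by (simp_all only: smooth_Pair lift)
qed

text \<open>The adjoint equation is dual to the linearised state equation: the motion of \<open>p\<close> contributes
  minus the derivatives of the drift and of the input field along \<open>V\<close>, which complete the
  derivative of \<open>V\<close> along the motion of the state to Lie brackets.\<close>

lemma extremal_derivative_inner:
  assumes P: "smooth (aug_drift P)" "smooth (aug_input P)" and V: "smooth V"
  shows "extremal_derivative P (\<lambda>X p. p \<bullet> V X) X p u =
    p \<bullet> lie_bracket (aug_drift P) V X + u * (p \<bullet> lie_bracket (aug_input P) V X)"
proof -
  let ?D = "\<lambda>F. frechet_derivative F (at X)"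
  have "((\<lambda>Y. p \<bullet> V Y) has_derivative (\<lambda>h. p \<bullet> ?D V h)) (at X)"
    by (intro has_derivative_inner_right smooth_has_derivative V)
  then have DX: "?D (\<lambda>Y. p \<bullet> V Y) = (\<lambda>h. p \<bullet> ?D V h)"
    using frechet_derivative_at by metis
  have Dp: "frechet_derivative (\<lambda>r. r \<bullet> V X) (at p) = (\<lambda>h. h \<bullet> V X)"
    by (intro frechet_derivative_at[symmetric] has_derivative_inner_left has_derivative_ident)
  have row: "row_times_jacobian p F X \<bullet> v = p \<bullet> ?D F v" if "smooth F" for F v
    unfolding row_times_jacobian_def
    using adjoint_works[OF has_derivative_linear[OF smooth_has_derivative[OF that]], of v X p]
    by (simp add: inner_commute)
  have lin: "linear (?D V)"
    by (rule has_derivative_linear[OF smooth_has_derivative[OF V]])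
  show ?thesis
    unfolding extremal_derivative_def DX Dp state_velocity_def adjoint_velocity_def lie_bracket_def
    by (simp add: linear_add[OF lin] linear_cmul[OF lin] row P inner_add_right inner_diff_right
        inner_diff_left inner_minus_left right_diff_distrib)
qed

text \<open>Each recursion step sees only the value of the previous function at \<open>u = 0\<close>, which is the
  pairing of \<open>p\<close> with an iterated bracket. Hence the formula holds at every level, also beyond
  the first appearance of the input.\<close>

lemma switching_eq_inner_bracket:
  assumes P: "smooth (aug_drift P)" "smooth (aug_input P)"
  defines "W \<equiv> \<lambda>l. (lie_bracket (aug_drift P) ^^ l) (aug_input P)"
  shows "switching P (Suc l) X p u = p \<bullet> W (Suc l) X + u * (p \<bullet> lie_bracket (aug_input P) (W l) X)"
proof -
  have W: "smooth (W l)" for l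
    unfolding W_def by (induction l) (simp_all add: P smooth_lie_bracket)
  have at_0: "(\<lambda>X p. switching P l X p 0) = (\<lambda>X p. p \<bullet> W l X)" for l
    by (induction l) (simp_all add: W_def extremal_derivative_inner[OF P W[unfolded W_def]])
  show ?thesis
    unfolding switching.simps at_0 extremal_derivative_inner[OF P W] by (simp add: W_def)
qed

theorem theorem3p1:
  fixes P :: "'n::finite control_problem"
  assumes "analytic_problem P"
    and "\<exists>l. input_appears P l"
  shows "problem_order P \<in> \<int> \<and> 0 < problem_order P"
proof -
  note P = smooth_aug_fields[OF assms(1)]
  define W where "W l = (lie_bracket (aug_drift P) ^^ l) (aug_input P)" for l
  have switching: "switching P (Suc l) X p u =
      p \<bullet> W (Suc l) X + u * (p \<bullet> lie_bracket (aug_input P) (W l) X)" for l X p u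
    unfolding W_def by (rule switching_eq_inner_bracket[OF P])
  define k where "k = (LEAST l. input_appears P l)"
  have k: "input_appears P k"
    unfolding k_def using assms(2) by (rule LeastI_ex)
  then obtain X p where "k \<noteq> 0" and "input_coeff P k X p \<noteq> 0"
    by (auto simp: input_appears_def)
  then obtain k' where k': "k = Suc k'" using not0_implies_Suc by blast
  have "input_coeff P k X p = p \<bullet> lie_bracket (aug_input P) (W k') X"
    unfolding input_coeff_def k' switching
    by (rule DERIV_imp_deriv) (auto intro!: derivative_eq_intros)
  with \<open>input_coeff P k X p \<noteq> 0\<close> have nonzero: "lie_bracket (aug_input P) (W k') \<noteq> (\<lambda>_. 0)"
    by auto
  have zero: "lie_bracket (aug_input P) (W l) = (\<lambda>_. 0)" if "l < k'" for l
  proof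
    fix Y
    let ?b = "lie_bracket (aug_input P) (W l) Y"
    \<comment> \<open>Taking the bracket itself as adjoint vector turns independence of \<open>u\<close> into a vanishing norm.\<close>
    have "switching P (Suc l) Y ?b 0 = switching P (Suc l) Y ?b 1"
      using k that unfolding input_appears_def switching_defined_def k' by (meson Suc_mono)
    then show "?b = 0" unfolding switching by simp
  qed
  have "odd k'"
  proof
    assume "even k'"
    then obtain m where "k' = 2 * m" by blast
    then show False
      using even_iterated_bracket_vanishes[OF P, of m] zero nonzero unfolding W_def by blast
  qed
  then obtain m where "k' = 2 * m + 1" by (rule oddE)
  then have "problem_order P = real (Suc m)"
    by (simp add: problem_order_def k_def[symmetric] k')
  then show ?thesis by (simp only: Ints_of_nat of_nat_0_less_iff zero_less_Suc)
qed

end
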